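(* Let $k\geq 0$ be an integer and let $G$ be a $k$-gap-planar graph. Then for every integer $r\geq 0$, $$\nabla_r(G)\leq 18(k+1)(r+1).$$
   Context: All graphs are simple, finite and undirected. A drawing of a graph $G$ in the plane represents each vertex by a distinct point and each edge $vw$ by a non-self-intersecting curve between the points of $v$ and $w$, such that no three edges cross at a single point. A drawing is $k$-gap-planar if every crossing can be charged to one of the two edges involved so that at most $k$ crossings are charged to each edge; a graph is $k$-gap-planar if it has a $k$-gap-planar drawing in the plane. The density of a graph $G$ is $|E(G)|/|V(G)|$ if $V(G)\neq\emptyset$, and $0$ otherwise. A model of a graph $H$ in $G$ is a map $\mu$ assigning to each $v\in V(H)$ a non-empty connected subgraph $\mu(v)$ of $G$, with $\mu(v)\cap\mu(w)=\emptyset$ for distinct $v,w$, and such that for every edge $vw\in E(H)$ some edge of $G$ joins $\mu(v)$ and $\mu(w)$. The model is $r$-shallow if each $\mu(v)$ has radius at most $r$; $H$ is an $r$-shallow minor of $G$ if such a model exists. $\nabla_r(G)$ denotes the maximum density of an $r$-shallow minor of $G$. *)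

theory Defs
  imports "HOL-Analysis.Analysis"
begin

definition simple_graph :: "'a set \<Rightarrow> 'a set set \<Rightarrow> bool" where
  "simple_graph V E \<longleftrightarrow> finite V \<and>
     (\<forall>e\<in>E. \<exists>u v. u \<in> V \<and> v \<in> V \<and> u \<noteq> v \<and> e = {u, v})"

definition density :: "'a set \<Rightarrow> 'a set set \<Rightarrow> real" where
  "density V E = (if V = {} then 0 else real (card E) / real (card V))"

definition curve_interior :: "(real \<Rightarrow> real \<times> real) \<Rightarrow> (real \<times> real) set" where
  "curve_interior g = g ` {0<..<1}"

definition drawing ::
  "'a set \<Rightarrow> 'a set set \<Rightarrow> ('a \<Rightarrow> real \<times> real) \<Rightarrow> ('a set \<Rightarrow> real \<Rightarrow> real \<times> real) \<Rightarrow> bool" where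
  "drawing V E p \<gamma> \<longleftrightarrow>
     inj_on p V \<and>
     (\<forall>e\<in>E. arc (\<gamma> e) \<and> {pathstart (\<gamma> e), pathfinish (\<gamma> e)} = p ` e) \<and>
     (\<forall>e\<in>E. \<forall>v\<in>V. p v \<notin> curve_interior (\<gamma> e)) \<and>
     (\<forall>x. card {e\<in>E. x \<in> curve_interior (\<gamma> e)} \<le> 2)"

definition crossings ::
  "'a set set \<Rightarrow> ('a set \<Rightarrow> real \<Rightarrow> real \<times> real) \<Rightarrow> ('a set set \<times> (real \<times> real)) set" where
  "crossings E \<gamma> = {({e, f}, x) | e f x. e \<in> E \<and> f \<in> E \<and> e \<noteq> f \<and>
       x \<in> curve_interior (\<gamma> e) \<and> x \<in> curve_interior (\<gamma> f)}"

definition k_gap_planar_drawing ::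
  "nat \<Rightarrow> 'a set \<Rightarrow> 'a set set \<Rightarrow> ('a \<Rightarrow> real \<times> real) \<Rightarrow> ('a set \<Rightarrow> real \<Rightarrow> real \<times> real) \<Rightarrow> bool" where
  "k_gap_planar_drawing k V E p \<gamma> \<longleftrightarrow> drawing V E p \<gamma> \<and>
     (\<exists>ch. (\<forall>c\<in>crossings E \<gamma>. ch c \<in> fst c) \<and>
           (\<forall>e\<in>E. finite {c\<in>crossings E \<gamma>. ch c = e} \<and>
                   card {c\<in>crossings E \<gamma>. ch c = e} \<le> k))"

definition k_gap_planar :: "nat \<Rightarrow> 'a set \<Rightarrow> 'a set set \<Rightarrow> bool" where
  "k_gap_planar k V E \<longleftrightarrow> (\<exists>p \<gamma>. k_gap_planar_drawing k V E p \<gamma>)"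

fun reach :: "'a set set \<Rightarrow> nat \<Rightarrow> 'a \<Rightarrow> 'a \<Rightarrow> bool" where
  "reach F 0 c w = (c = w)"
| "reach F (Suc n) c w = (reach F n c w \<or> (\<exists>u. reach F n c u \<and> {u, w} \<in> F))"

definition is_subgraph :: "'a set \<Rightarrow> 'a set set \<Rightarrow> 'a set \<Rightarrow> 'a set set \<Rightarrow> bool" where
  "is_subgraph W F V E \<longleftrightarrow> W \<subseteq> V \<and> F \<subseteq> E \<and> (\<forall>e\<in>F. e \<subseteq> W)"

definition connected_graph :: "'a set \<Rightarrow> 'a set set \<Rightarrow> bool" where
  "connected_graph W F \<longleftrightarrow> (\<forall>a\<in>W. \<forall>b\<in>W. \<exists>n. reach F n a b)"

definition radius_le :: "'a set \<Rightarrow> 'a set set \<Rightarrow> nat \<Rightarrow> bool" where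
  "radius_le W F r \<longleftrightarrow> (\<exists>c\<in>W. \<forall>w\<in>W. reach F r c w)"

definition shallow_model ::
  "nat \<Rightarrow> 'b set \<Rightarrow> 'b set set \<Rightarrow> 'a set \<Rightarrow> 'a set set \<Rightarrow> ('b \<Rightarrow> 'a set \<times> 'a set set) \<Rightarrow> bool" where
  "shallow_model r VH EH V E mu \<longleftrightarrow>
     (\<forall>v\<in>VH. fst (mu v) \<noteq> {} \<and> is_subgraph (fst (mu v)) (snd (mu v)) V E \<and>
             connected_graph (fst (mu v)) (snd (mu v)) \<and>
             radius_le (fst (mu v)) (snd (mu v)) r) \<and>
     (\<forall>v\<in>VH. \<forall>w\<in>VH. v \<noteq> w \<longrightarrow> fst (mu v) \<inter> fst (mu w) = {}) \<and>
     (\<forall>v w. {v, w} \<in> EH \<longrightarrow> (\<exists>a\<in>fst (mu v). \<exists>b\<in>fst (mu w). {a, b} \<in> E))"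

definition shallow_minor :: "nat \<Rightarrow> 'b set \<Rightarrow> 'b set set \<Rightarrow> 'a set \<Rightarrow> 'a set set \<Rightarrow> bool" where
  "shallow_minor r VH EH V E \<longleftrightarrow> (\<exists>mu. shallow_model r VH EH V E mu)"

text \<open>nabla_r(G): maximum density of an r-shallow minor of G. Minors are taken
  (up to isomorphism) with vertex set a finite set of naturals.\<close>
definition nabla :: "nat \<Rightarrow> 'a set \<Rightarrow> 'a set set \<Rightarrow> real" where
  "nabla r V E = Sup {density VH EH | (VH :: nat set) EH.
                       simple_graph VH EH \<and> shallow_minor r VH EH V E}"

end

theory Submission
  imports Defs
begin

text \<open>
  Call a graph weakly drawable if its vertices can be placed in the plane and its edges realised by
  path-connected sets joining their end points so that independent edges get disjoint sets. This
  property is preserved by deletion and contraction, and \<open>K\<^sub>5\<close> does not have it, so Mader's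
  contraction argument bounds the number of edges by \<open>3n\<close>.

  Given an \<open>r\<close>-shallow minor \<open>H\<close> of a \<open>k\<close>-gap-planar graph, route each edge of \<open>H\<close> between the centres
  of two branch sets along at most \<open>2r + 1\<close> edges of \<open>G\<close>. At most \<open>D = k(2r + 1)\<close> crossings are
  charged to such a route, and each gives at most one vertex of \<open>H\<close> that conflicts with it. Keep
  every vertex of \<open>H\<close> with probability \<open>1/(D + 1)\<close>, and keep the edges whose ends are kept and whose
  conflicting vertices are not. What remains is weakly drawable, so
  \<open>|E(H)| p\<^sup>2 (1 - p)\<^sup>D \<le> 3 p |V(H)|\<close>, where \<open>(1 - p)\<^sup>D \<ge> 1/3\<close>.
\<close>

section \<open>Nonplanarity of the complete graph on five vertices\<close>

text \<open>For a closed path this is \<open>2 * pi * \<i>\<close> times the winding number around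
  0. Open paths are allowed, because the relations below concern single edges.\<close>

definition log_increment :: "(real \<Rightarrow> complex) \<Rightarrow> complex" where
  "log_increment h = (THE d. \<exists>G. continuous_on {0..1} G \<and> (\<forall>t\<in>{0..1}. h t = exp (G t)) \<and> d = G 1 - G 0)"

text \<open>Two logarithms differ by integer multiples of \<open>2 * pi * \<i>\<close>, and a
  continuous function with discrete range is constant on an interval. Hence
  \<open>log_increment\<close> is well defined.\<close>

lemma continuous_logarithms_differ_by_constant:
  fixes G H :: "real \<Rightarrow> complex"
  assumes "continuous_on {0..1} G" "continuous_on {0..1} H"
    and "\<And>t. t \<in> {0..1} \<Longrightarrow> exp (G t) = exp (H t)"
  shows "G 1 - G 0 = H 1 - H 0"
proof -
  have "(\<lambda>t. G t - H t) constant_on {0..1}"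
  proof (rule continuous_discrete_range_constant)
    fix x :: real assume x: "x \<in> {0..1}"
    have "2 * pi \<le> norm ((G y - H y) - (G x - H x))"
      if y: "y \<in> {0..1}" and ne: "G y - H y \<noteq> G x - H x" for y
    proof -
      obtain n m :: int where
        n: "G y = H y + (of_int (2 * n) * pi) * \<i>" and m: "G x = H x + (of_int (2 * m) * pi) * \<i>"
        using assms(3)[OF x] assms(3)[OF y] unfolding exp_eq by blast
      have eq: "(G y - H y) - (G x - H x) = of_real (2 * pi * of_int (n - m)) * \<i>"
        by (simp add: n m algebra_simps)
      have "n \<noteq> m" using ne n m by auto
      then have "1 \<le> \<bar>n - m\<bar>" by linarith
      then have "1 \<le> \<bar>real_of_int (n - m)\<bar>" by linarith
      then have "2 * pi * 1 \<le> 2 * pi * \<bar>real_of_int (n - m)\<bar>"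
        by (intro mult_left_mono) auto
      then show ?thesis
        unfolding eq norm_mult norm_of_real by (simp add: abs_mult)
    qed
    then show "\<exists>e>0. \<forall>y. y \<in> {0..1} \<and> G y - H y \<noteq> G x - H x
         \<longrightarrow> e \<le> norm ((G y - H y) - (G x - H x))"
      by (intro exI[of _ "2 * pi"]) auto
  qed (use assms in \<open>auto intro!: continuous_intros\<close>)
  then obtain c where "\<And>t. t \<in> {0..1} \<Longrightarrow> G t - H t = c"
    unfolding constant_on_def by blast
  from this[of 0] this[of 1] show ?thesis
    by (simp add: algebra_simps)
qed

lemma log_increment_eq:
  assumes "continuous_on {0..1} G" "\<And>t. t \<in> {0..1} \<Longrightarrow> h t = exp (G t)"
  shows "log_increment h = G 1 - G 0"
  unfolding log_increment_def
proof (rule the_equality)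
  show "\<exists>G'. continuous_on {0..1} G' \<and> (\<forall>t\<in>{0..1}. h t = exp (G' t)) \<and> G 1 - G 0 = G' 1 - G' 0"
    using assms by blast
  show "d = G 1 - G 0"
    if "\<exists>G'. continuous_on {0..1} G' \<and> (\<forall>t\<in>{0..1}. h t = exp (G' t)) \<and> d = G' 1 - G' 0" for d
    using that assms continuous_logarithms_differ_by_constant[of _ G] by metis
qed

lemma exp_log_increment:
  assumes "continuous_on {0..1} h" "\<And>t. t \<in> {0..1} \<Longrightarrow> h t \<noteq> 0"
  shows "exp (log_increment h) = h 1 / h 0"
proof -
  obtain G where "continuous_on {0..1} G" "\<And>t. t \<in> {0..1} \<Longrightarrow> h t = exp (G t)"
    using continuous_logarithm_on_contractible[of "{0..1}" h] assms
      convex_imp_contractible[of "{0..1::real}"] by auto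
  then show ?thesis using log_increment_eq[of G h] by (simp add: exp_diff)
qed

text \<open>The difference \<open>g s - k t\<close> has no zero on the unit square, so it has a
  continuous logarithm \<open>L\<close> there. Both sides are the change of \<open>L\<close> from
  \<open>(0, 0)\<close> to \<open>(1, 1)\<close>, taken along two different pairs of sides.\<close>

lemma log_increment_square:
  fixes g k :: "real \<Rightarrow> complex"
  assumes "path g" "path k" and disj: "path_image g \<inter> path_image k = {}"
  shows "log_increment (\<lambda>s. g s - k 0) + log_increment (\<lambda>t. k t - g 1)
       = log_increment (\<lambda>t. k t - g 0) + log_increment (\<lambda>s. g s - k 1)"
proof -
  let ?Q = "{0..1::real} \<times> {0..1::real}"
  have cont: "continuous_on {0..1} g" "continuous_on {0..1} k"
    using assms by (auto simp: path_def)
  have "continuous_on ?Q (\<lambda>z. g (fst z) - k (snd z))"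
    by (intro continuous_intros continuous_on_compose2[OF cont(1)] continuous_on_compose2[OF cont(2)]) auto
  moreover have "contractible ?Q"
    by (intro convex_imp_contractible convex_Times) auto
  moreover have "g (fst z) - k (snd z) \<noteq> 0" if "z \<in> ?Q" for z
    using disj that unfolding path_image_def by fastforce
  ultimately obtain L where L: "continuous_on ?Q L"
    and eL: "\<And>z. z \<in> ?Q \<Longrightarrow> g (fst z) - k (snd z) = exp (L z)"
    using continuous_logarithm_on_contractible by blast
  have row: "log_increment (\<lambda>s. g s - k c) = L (1, c) - L (0, c)" if "c \<in> {0..1}" for c
    by (rule log_increment_eq[of "\<lambda>s. L (s, c)"])
       (use that eL[of "(_, c)"] in \<open>auto intro!: continuous_intros continuous_on_compose2[OF L]\<close>)
  have col: "log_increment (\<lambda>t. k t - g c) = L (c, 1) - L (c, 0)" if "c \<in> {0..1}" for c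
  proof -
    \<comment> \<open>On columns the sign is reversed, which shifts the logarithm by
      \<open>\<i> * pi\<close>; the shift cancels in the change.\<close>
    have "log_increment (\<lambda>t. k t - g c) = (L (c, 1) + \<i> * pi) - (L (c, 0) + \<i> * pi)"
    proof (rule log_increment_eq[of "\<lambda>t. L (c, t) + \<i> * pi"])
      show "continuous_on {0..1} (\<lambda>t. L (c, t) + \<i> * pi)"
        using that by (auto intro!: continuous_intros continuous_on_compose2[OF L])
      show "k t - g c = exp (L (c, t) + \<i> * pi)" if "t \<in> {0..1}" for t
        using eL[of "(c, t)"] that \<open>c \<in> _\<close> by (simp add: exp_add minus_diff_eq[symmetric, of "k t"])
    qed
    then show ?thesis by simp
  qed
  show ?thesis
    using row[of 0] row[of 1] col[of 0] col[of 1] by simp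
qed

text \<open>Path-connected sets replace curves so that a contraction can simply take unions. Edges
  with a common end may meet freely.\<close>

definition weak_drawing :: "'b set set \<Rightarrow> ('b \<Rightarrow> complex) \<Rightarrow> ('b set \<Rightarrow> complex set) \<Rightarrow> bool" where
  "weak_drawing E q S \<longleftrightarrow>
     (\<forall>e\<in>E. path_connected (S e) \<and> q ` e \<subseteq> S e) \<and>
     (\<forall>e\<in>E. \<forall>f\<in>E. e \<inter> f = {} \<longrightarrow> S e \<inter> S f = {})"

text \<open>The vertex set is a dummy argument: it gives the class the shape expected of graph classes.\<close>

definition weakly_drawable :: "'b set \<Rightarrow> 'b set set \<Rightarrow> bool" where
  "weakly_drawable V E \<longleftrightarrow> (\<exists>q S. weak_drawing E q S)"

text \<open>
  For an edge \<open>ij\<close> and a vertex \<open>m\<close> let \<open>D m i j\<close> be the change of the logarithm of \<open>z - c m\<close> as \<open>z\<close>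
  runs along \<open>ij\<close>. Two disjoint edges yield a map from a square to the punctured plane, hence a
  linear relation between four of these numbers. Altogether these relations force the change \<open>W4\<close>
  around the closed curve \<open>1231\<close> seen from \<open>4\<close> to equal the change \<open>h\<close> of the difference of two
  points that exchange their places \<open>1\<close> and \<open>2\<close> by moving in turn along the edges of that triangle,
  but \<open>exp W4 = 1\<close> and \<open>exp h = -1\<close>.
\<close>

lemma K5_not_weakly_drawable:
  fixes v :: "nat \<Rightarrow> 'b"
  assumes inj: "inj_on v {1..5}"
    and sub: "\<And>i j. i \<in> {1..5} \<Longrightarrow> j \<in> {1..5} \<Longrightarrow> i < j \<Longrightarrow> {v i, v j} \<in> E"
  shows "\<not> weakly_drawable V E"
proof
  assume "weakly_drawable V E"
  then obtain q S where W: "weak_drawing E q S" unfolding weakly_drawable_def by blast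
  define c where "c i = q (v i)" for i
  define g where "g i j = (SOME p. path p \<and> path_image p \<subseteq> S {v i, v j} \<and>
      pathstart p = c i \<and> pathfinish p = c j)" for i j
  have g: "path (g i j) \<and> path_image (g i j) \<subseteq> S {v i, v j} \<and> g i j 0 = c i \<and> g i j 1 = c j"
    if "i \<in> {1..5}" "j \<in> {1..5}" "i < j" for i j
  proof -
    have "path_connected (S {v i, v j})" "c i \<in> S {v i, v j}" "c j \<in> S {v i, v j}"
      using W sub[OF that] unfolding weak_drawing_def c_def by blast+
    then have "\<exists>p. path p \<and> path_image p \<subseteq> S {v i, v j} \<and> pathstart p = c i \<and> pathfinish p = c j"
      unfolding path_connected_def by blast
    from someI_ex[OF this] show ?thesis
      unfolding g_def[symmetric] by (auto simp: pathstart_def pathfinish_def)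
  qed
  have disj: "path_image (g i j) \<inter> path_image (g k l) = {}"
    if "i \<in> {1..5}" "j \<in> {1..5}" "i < j" "k \<in> {1..5}" "l \<in> {1..5}" "k < l" "{i, j} \<inter> {k, l} = {}"
    for i j k l
  proof -
    have "{v i, v j} \<inter> {v k, v l} = {}"
      using that inj_onD[OF inj] by (auto simp: disjoint_iff)
    then have "S {v i, v j} \<inter> S {v k, v l} = {}"
      using W sub[OF that(1-3)] sub[OF that(4-6)] unfolding weak_drawing_def by simp
    then show ?thesis using g[OF that(1-3)] g[OF that(4-6)] by blast
  qed
  define D where "D m i j = log_increment (\<lambda>t. g i j t - c m)" for m i j
  have sq: "D k i j + D j k l = D i k l + D l i j"
    if "i \<in> {1..5}" "j \<in> {1..5}" "i < j" "k \<in> {1..5}" "l \<in> {1..5}" "k < l" "{i, j} \<inter> {k, l} = {}"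
    for i j k l
    using log_increment_square[OF _ _ disj[OF that]] g[of i j] g[of k l] that
    unfolding D_def by auto
  have avoid: "c k \<notin> path_image (g i j) \<and> c l \<notin> path_image (g i j)"
    if "i \<in> {1..5}" "j \<in> {1..5}" "i < j" "k \<in> {1..5}" "l \<in> {1..5}" "k < l" "{i, j} \<inter> {k, l} = {}"
    for i j k l
    using disj[OF that] g[of k l] that(4-6) unfolding path_image_def by force
  \<comment> \<open>Vertex 5 is held in reserve: the edge \<open>{k, 5}\<close> is disjoint from
    \<open>{i, j}\<close>, so \<open>c k\<close> lies off the path \<open>g i j\<close>.\<close>
  have ex: "exp (D k i j) = (c j - c k) / (c i - c k) \<and> c j \<noteq> c k \<and> c i \<noteq> c k"
    if "i \<in> {1..5}" "j \<in> {1..5}" "i < j" "k \<in> {1..5}" "k < 5" "j < 5" "k \<noteq> i" "k \<noteq> j" for i j k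
  proof -
    have a: "c k \<notin> path_image (g i j)" using avoid[of i j k 5] that by auto
    have "exp (D k i j) = (g i j 1 - c k) / (g i j 0 - c k)"
      unfolding D_def
    proof (rule exp_log_increment)
      show "continuous_on {0..1} (\<lambda>t. g i j t - c k)"
        using g[of i j] that by (auto simp: path_def intro!: continuous_intros)
      show "g i j t - c k \<noteq> 0" if "t \<in> {0..1}" for t
        using a that by (force simp: path_image_def)
    qed
    moreover have "g i j 0 \<in> path_image (g i j)" "g i j 1 \<in> path_image (g i j)"
      by (auto simp: path_image_def)
    ultimately show ?thesis using g[of i j] that a by auto
  qed
  define W4 where "W4 = D 4 1 2 + D 4 2 3 - D 4 1 3"
  define h where "h = D 1 2 3 + D 3 1 2 - D 2 1 3"
  have "exp W4 = 1"
    using ex[of 1 2 4] ex[of 2 3 4] ex[of 1 3 4]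
    by (simp add: W4_def exp_add exp_diff)
  moreover have "exp h = -1"
  proof -
    have ne: "c 1 \<noteq> c 2" "c 1 \<noteq> c 3" "c 2 \<noteq> c 3" using ex[of 1 2 3] ex[of 1 3 2] by auto
    have "exp h = ((c 3 - c 1) / (c 2 - c 1)) * ((c 2 - c 3) / (c 1 - c 3)) / ((c 3 - c 2) / (c 1 - c 2))"
      using ex[of 2 3 1] ex[of 1 2 3] ex[of 1 3 2] by (simp add: h_def exp_add exp_diff)
    also have "\<dots> = -1" using ne by (simp add: divide_simps) (simp add: algebra_simps)
    finally show ?thesis .
  qed
  moreover have "W4 = h"
  proof -
    \<comment> \<open>These are the three pairs of disjoint edges within
      \<open>{1, 2, 3, 4}\<close>.\<close>
    have s4: "D 3 1 2 + D 2 3 4 = D 1 3 4 + D 4 1 2"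
      "D 2 1 3 + D 3 2 4 = D 1 2 4 + D 4 1 3"
      "D 2 1 4 + D 4 2 3 = D 1 2 3 + D 3 1 4"
      by (rule sq; simp)+
    have s5: "D 1 4 5 + D 5 1 2 = D 4 1 2 + D 2 4 5" "D 2 4 5 + D 5 2 3 = D 4 2 3 + D 3 4 5"
      "D 1 4 5 + D 5 1 3 = D 4 1 3 + D 3 4 5"
      "D 1 3 5 + D 5 1 2 = D 3 1 2 + D 2 3 5" "D 2 3 5 + D 5 2 4 = D 3 2 4 + D 4 3 5"
      "D 1 3 5 + D 5 1 4 = D 3 1 4 + D 4 3 5"
      "D 1 2 5 + D 5 1 3 = D 2 1 3 + D 3 2 5" "D 3 2 5 + D 5 3 4 = D 2 3 4 + D 4 2 5"
      "D 1 2 5 + D 5 1 4 = D 2 1 4 + D 4 2 5"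
      "D 2 1 5 + D 5 2 3 = D 1 2 3 + D 3 1 5" "D 3 1 5 + D 5 3 4 = D 1 3 4 + D 4 1 5"
      "D 2 1 5 + D 5 2 4 = D 1 2 4 + D 4 1 5"
      using sq[of 4 5 1 2] sq[of 4 5 2 3] sq[of 4 5 1 3] sq[of 3 5 1 2] sq[of 3 5 2 4]
        sq[of 3 5 1 4] sq[of 2 5 1 3] sq[of 2 5 3 4] sq[of 2 5 1 4] sq[of 1 5 2 3]
        sq[of 1 5 3 4] sq[of 1 5 2 4] by simp_all
    \<comment> \<open>For each \<open>m \<le> 4\<close> the edge from \<open>m\<close> to 5 is
      disjoint from the triangle on the other three vertices of \<open>{1, 2, 3, 4}\<close>, so the
      change around this triangle is the same seen from \<open>m\<close> and from 5.\<close>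
    have t4: "D 4 1 2 + D 4 2 3 - D 4 1 3 = D 5 1 2 + D 5 2 3 - D 5 1 3" using s5(1-3) by algebra
    have t3: "D 3 1 2 + D 3 2 4 - D 3 1 4 = D 5 1 2 + D 5 2 4 - D 5 1 4" using s5(4-6) by algebra
    have t2: "D 2 1 3 + D 2 3 4 - D 2 1 4 = D 5 1 3 + D 5 3 4 - D 5 1 4" using s5(7-9) by algebra
    have t1: "D 1 2 3 + D 1 3 4 - D 1 2 4 = D 5 2 3 + D 5 3 4 - D 5 2 4" using s5(10-12) by algebra
    \<comment> \<open>Substituting \<open>s4\<close> and then \<open>t1\<close>, \<open>t2\<close>,
      \<open>t3\<close> into \<open>W4\<close> leaves \<open>2 * h\<close> minus the change around
      1231 seen from 5, which is \<open>W4\<close> again by \<open>t4\<close>.\<close>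
    have "2 * W4 = 2 * h" unfolding W4_def h_def using s4 t4 t3 t2 t1 by algebra
    then show ?thesis by simp
  qed
  ultimately show False by simp
qed

section \<open>Edge bounds for minor-closed classes\<close>

lemma simple_graph_edgeE:
  assumes "simple_graph V E" "e \<in> E"
  obtains u v where "u \<in> V" "v \<in> V" "u \<noteq> v" "e = {u, v}"
  using assms unfolding simple_graph_def by blast

lemma simple_graph_edgeD:
  assumes "simple_graph V E" "{u, v} \<in> E"
  shows "u \<in> V" "v \<in> V" "u \<noteq> v"
proof -
  obtain a b where "a \<in> V" "b \<in> V" "a \<noteq> b" "{u, v} = {a, b}"
    using simple_graph_edgeE[OF assms] by blast
  then show "u \<in> V" "v \<in> V" "u \<noteq> v" by (auto simp: doubleton_eq_iff)
qed

lemma simple_graph_card_edge: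
  assumes "simple_graph V E" "e \<in> E"
  shows "card e = 2" "e \<subseteq> V"
proof -
  obtain a b where "a \<in> V" "b \<in> V" "a \<noteq> b" "e = {a, b}"
    using simple_graph_edgeE[OF assms] by blast
  then show "card e = 2" "e \<subseteq> V" by auto
qed

lemma simple_graph_finite:
  assumes "simple_graph V E"
  shows "finite V" "finite E" "E \<subseteq> Pow V"
proof -
  show "finite V" using assms by (simp add: simple_graph_def)
  show "E \<subseteq> Pow V" using simple_graph_card_edge(2)[OF assms] by auto
  then show "finite E" using \<open>finite V\<close> by (meson finite_Pow_iff finite_subset)
qed

lemma simple_graph_subgraph:
  assumes "simple_graph V E" "V' \<subseteq> V" "E' \<subseteq> E" "\<And>e. e \<in> E' \<Longrightarrow> e \<subseteq> V'"
  shows "simple_graph V' E'"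
  unfolding simple_graph_def
proof (intro conjI ballI)
  show "finite V'" using finite_subset[OF assms(2) simple_graph_finite(1)[OF assms(1)]] .
  fix e assume "e \<in> E'"
  then have "e \<in> E" using assms(3) by blast
  then obtain u v where "u \<noteq> v" "e = {u, v}" using simple_graph_edgeE[OF assms(1)] by metis
  then show "\<exists>u v. u \<in> V' \<and> v \<in> V' \<and> u \<noteq> v \<and> e = {u, v}" using assms(4)[OF \<open>e \<in> E'\<close>] by blast
qed

lemma sum_degrees_eq:
  assumes "simple_graph V E"
  shows "(\<Sum>x\<in>V. card {e\<in>E. x \<in> e}) = 2 * card E"
proof -
  note fin = simple_graph_finite[OF assms]
  have "(\<Sum>x\<in>V. card {e\<in>E. x \<in> e}) = (\<Sum>x\<in>V. \<Sum>e\<in>E. if x \<in> e then 1 else 0)"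
    using fin by (simp add: sum.If_cases Int_def)
  also have "\<dots> = (\<Sum>e\<in>E. \<Sum>x\<in>V. if x \<in> e then 1 else 0)" by (rule sum.swap)
  also have "\<dots> = (\<Sum>e\<in>E. 2)"
  proof (rule sum.cong[OF refl])
    fix e assume "e \<in> E"
    then have "V \<inter> {x. x \<in> e} = e" "card e = 2" using simple_graph_card_edge[OF assms] by auto
    then show "(\<Sum>x\<in>V. if x \<in> e then 1 else 0) = (2::nat)" using fin by (simp add: sum.If_cases)
  qed
  finally show ?thesis by simp
qed

section \<open>Neighbourhoods and edge contraction\<close>

definition nbrs :: "'b set set \<Rightarrow> 'b \<Rightarrow> 'b set" where
  "nbrs E v = {x. {v, x} \<in> E}"

lemma nbrs_subset:
  assumes "simple_graph V E"
  shows "nbrs E v \<subseteq> V - {v}"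
proof
  fix x assume "x \<in> nbrs E v"
  then have "{v, x} \<in> E" by (simp add: nbrs_def)
  then show "x \<in> V - {v}" using simple_graph_edgeD[OF assms, of v x] by simp
qed

lemma finite_nbrs: "simple_graph V E \<Longrightarrow> finite (nbrs E v)"
  using nbrs_subset simple_graph_finite(1) by (metis finite_Diff finite_subset)

lemma card_nbrs:
  assumes "simple_graph V E"
  shows "card (nbrs E v) = card {e\<in>E. v \<in> e}"
proof -
  have "bij_betw (\<lambda>x. {v, x}) (nbrs E v) {e\<in>E. v \<in> e}"
    unfolding bij_betw_def
  proof
    show "inj_on (\<lambda>x. {v, x}) (nbrs E v)" by (auto simp: inj_on_def doubleton_eq_iff)
    show "(\<lambda>x. {v, x}) ` nbrs E v = {e\<in>E. v \<in> e}"
    proof (intro equalityI subsetI)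
      fix e assume "e \<in> {e\<in>E. v \<in> e}"
      then have "e \<in> E" "v \<in> e" by auto
      obtain a b where "e = {a, b}" using simple_graph_edgeE[OF assms \<open>e \<in> E\<close>] by metis
      then obtain x where "e = {v, x}" using \<open>v \<in> e\<close> by auto
      then show "e \<in> (\<lambda>x. {v, x}) ` nbrs E v" using \<open>e \<in> E\<close> by (auto simp: nbrs_def)
    qed (auto simp: nbrs_def)
  qed
  then show ?thesis by (rule bij_betw_same_card)
qed

text \<open>The merged vertex keeps the name \<open>u\<close>. Excluding \<open>u\<close> from the
  neighbours of \<open>v\<close> avoids a loop, and the set of edges merges parallel ones.\<close>

definition contract :: "'b \<Rightarrow> 'b \<Rightarrow> 'b set set \<Rightarrow> 'b set set" where
  "contract u v E = {e\<in>E. v \<notin> e} \<union> (\<lambda>x. {u, x}) ` (nbrs E v - {u})"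

lemma simple_graph_contract:
  assumes "simple_graph V E" "{u, v} \<in> E"
  shows "simple_graph (V - {v}) (contract u v E)"
  unfolding simple_graph_def
proof (intro conjI ballI)
  show "finite (V - {v})" using simple_graph_finite[OF assms(1)] by simp
  fix e assume "e \<in> contract u v E"
  then consider "e \<in> E" "v \<notin> e" | x where "x \<in> nbrs E v" "x \<noteq> u" "e = {u, x}"
    unfolding contract_def by blast
  then show "\<exists>a b. a \<in> V - {v} \<and> b \<in> V - {v} \<and> a \<noteq> b \<and> e = {a, b}"
  proof cases
    case 1
    obtain a b where "a \<in> V" "b \<in> V" "a \<noteq> b" "e = {a, b}"
      using simple_graph_edgeE[OF assms(1) \<open>e \<in> E\<close>] by metis
    then show ?thesis using \<open>v \<notin> e\<close> by blast
  next
    case 2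
    then show ?thesis using nbrs_subset[OF assms(1), of v] simple_graph_edgeD[OF assms] by blast
  qed
qed

text \<open>The edges lost are \<open>uv\<close> itself and, for each common neighbour
  \<open>x\<close>, one of the edges \<open>ux\<close> and \<open>vx\<close> that become
  parallel.\<close>

lemma card_contract:
  assumes "simple_graph V E" "{u, v} \<in> E"
  shows "card E \<le> card (contract u v E) + 1 + card (nbrs E u \<inter> nbrs E v)"
proof -
  note fin = simple_graph_finite[OF assms(1)]
  note fn = finite_nbrs[OF assms(1)]
  let ?X = "nbrs E v - {u} - nbrs E u"
  have u: "u \<in> nbrs E v" using assms by (auto simp: nbrs_def insert_commute)
  have "card (nbrs E v) = card (insert u (?X \<union> (nbrs E u \<inter> nbrs E v)))"
    using u by (intro arg_cong[of _ _ card]) auto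
  also have "\<dots> \<le> 1 + card ?X + card (nbrs E u \<inter> nbrs E v)"
    using card_Un_le[of ?X "nbrs E u \<inter> nbrs E v"] fn
    by (simp add: card_insert_if del: Un_Diff_Int)
  finally have nv: "card (nbrs E v) \<le> 1 + card ?X + card (nbrs E u \<inter> nbrs E v)" .
  have "card E = card ({e\<in>E. v \<notin> e} \<union> {e\<in>E. v \<in> e})"
    by (intro arg_cong[of _ _ card]) auto
  also have "\<dots> = card {e\<in>E. v \<notin> e} + card (nbrs E v)"
    unfolding card_nbrs[OF assms(1)] using fin by (intro card_Un_disjoint) auto
  finally have E: "card E = card {e\<in>E. v \<notin> e} + card (nbrs E v)" .
  have "card ((\<lambda>x. {u, x}) ` ?X) = card ?X"
    by (intro card_image) (auto simp: inj_on_def doubleton_eq_iff)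
  then have "card {e\<in>E. v \<notin> e} + card ?X = card ({e\<in>E. v \<notin> e} \<union> (\<lambda>x. {u, x}) ` ?X)"
    using fin fn by (subst card_Un_disjoint) (auto simp: nbrs_def)
  also have "\<dots> \<le> card (contract u v E)"
    using simple_graph_finite[OF simple_graph_contract[OF assms]]
    by (intro card_mono) (auto simp: contract_def)
  finally show ?thesis using nv E by linarith
qed

section \<open>Minor-closed classes and cones\<close>

definition minor_closed :: "('b set \<Rightarrow> 'b set set \<Rightarrow> bool) \<Rightarrow> bool" where
  "minor_closed P \<longleftrightarrow>
     (\<forall>V E V' E'. simple_graph V E \<and> P V E \<and> V' \<subseteq> V \<and> E' \<subseteq> E \<and> simple_graph V' E' \<longrightarrow> P V' E') \<and>
     (\<forall>V E u v. simple_graph V E \<and> P V E \<and> {u, v} \<in> E \<longrightarrow> P (V - {v}) (contract u v E))"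

lemma minor_closed_subgraph:
  assumes "minor_closed P" "simple_graph V E" "P V E" "V' \<subseteq> V" "E' \<subseteq> E" "simple_graph V' E'"
  shows "P V' E'"
  using assms unfolding minor_closed_def by blast

lemma minor_closed_contract:
  assumes "minor_closed P" "simple_graph V E" "P V E" "{u, v} \<in> E"
  shows "P (V - {v}) (contract u v E)"
  using assms unfolding minor_closed_def by blast

definition cone_edges :: "'b \<Rightarrow> 'b set \<Rightarrow> 'b set set \<Rightarrow> 'b set set" where
  "cone_edges z V E = E \<union> (\<lambda>x. {z, x}) ` V"

text \<open>The neighbourhood of a vertex \<open>z\<close> in a graph of the class \<open>P\<close>
  lies in this class, for which a bound with smaller \<open>s\<close> is available. The apex is
  fixed in advance, so that the vertex type stays the same.\<close>

definition cone_class :: "'b \<Rightarrow> ('b set \<Rightarrow> 'b set set \<Rightarrow> bool) \<Rightarrow> 'b set \<Rightarrow> 'b set set \<Rightarrow> bool" where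
  "cone_class z P V E \<longleftrightarrow> z \<notin> V \<and> P (insert z V) (cone_edges z V E)"

lemma simple_graph_cone:
  assumes "simple_graph V E" "z \<notin> V"
  shows "simple_graph (insert z V) (cone_edges z V E)"
  unfolding simple_graph_def
proof (intro conjI ballI)
  show "finite (insert z V)" using simple_graph_finite[OF assms(1)] by simp
  fix e assume "e \<in> cone_edges z V E"
  then consider "e \<in> E" | x where "x \<in> V" "e = {z, x}" unfolding cone_edges_def by blast
  then show "\<exists>u v. u \<in> insert z V \<and> v \<in> insert z V \<and> u \<noteq> v \<and> e = {u, v}"
  proof cases
    case 1
    then show ?thesis using assms(1) unfolding simple_graph_def by blast
  next
    case 2
    then show ?thesis using assms(2) by blast
  qed
qed

text \<open>The cone over a subgraph is a subgraph of the cone, and the cone over a contraction is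
  contained in the contraction of the cone.\<close>

lemma minor_closed_cone_class:
  assumes "minor_closed P"
  shows "minor_closed (cone_class z P)"
  unfolding minor_closed_def
proof (intro conjI allI impI; elim conjE)
  fix V V' :: "'a set" and E E'
  assume a: "simple_graph V E" "cone_class z P V E" "V' \<subseteq> V" "E' \<subseteq> E" "simple_graph V' E'"
  then have z: "z \<notin> V" "z \<notin> V'" by (auto simp: cone_class_def)
  have "P (insert z V') (cone_edges z V' E')"
    by (rule minor_closed_subgraph[OF assms simple_graph_cone[OF a(1) z(1)] _ _ _
          simple_graph_cone[OF a(5) z(2)]])
       (use a in \<open>auto simp: cone_class_def cone_edges_def\<close>)
  then show "cone_class z P V' E'" using z by (simp add: cone_class_def)
next
  fix V :: "'a set" and E u v
  assume a: "simple_graph V E" "cone_class z P V E" "{u, v} \<in> E"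
  then have z: "z \<notin> V" by (auto simp: cone_class_def)
  note uv = simple_graph_edgeD[OF a(1,3)]
  note sc = simple_graph_cone[OF a(1) z]
  have e: "{u, v} \<in> cone_edges z V E" using a by (simp add: cone_edges_def)
  have "P (insert z V - {v}) (contract u v (cone_edges z V E))"
    by (rule minor_closed_contract[OF assms sc _ e]) (use a(2) in \<open>simp add: cone_class_def\<close>)
  then have "P (insert z (V - {v})) (cone_edges z (V - {v}) (contract u v E))"
  proof (rule minor_closed_subgraph[OF assms simple_graph_contract[OF sc e]])
    show "insert z (V - {v}) \<subseteq> insert z V - {v}" using z uv by auto
    show "simple_graph (insert z (V - {v})) (cone_edges z (V - {v}) (contract u v E))"
      using z by (intro simple_graph_cone simple_graph_contract a) auto
    have "nbrs E v \<subseteq> nbrs (cone_edges z V E) v" by (auto simp: nbrs_def cone_edges_def)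
    then show "cone_edges z (V - {v}) (contract u v E) \<subseteq> contract u v (cone_edges z V E)"
      using z uv unfolding contract_def by (auto simp: cone_edges_def)
  qed
  then show "cone_class z P (V - {v}) (contract u v E)" using z by (simp add: cone_class_def)
qed

text \<open>When \<open>uv\<close> is contracted, a new edge \<open>ux\<close> receives the sets of
  \<open>uv\<close> and \<open>vx\<close>, which meet in \<open>q v\<close>. An edge of the
  contraction that was present before misses \<open>v\<close>, so if it is disjoint from
  \<open>ux\<close> its set avoids both. Two new edges share \<open>u\<close>.\<close>

lemma minor_closed_weakly_drawable: "minor_closed weakly_drawable"
  unfolding minor_closed_def
proof (intro conjI allI impI; elim conjE)
  fix V V' :: "'a set" and E E'
  assume "weakly_drawable V E" "E' \<subseteq> E"
  then show "weakly_drawable V' E'" unfolding weakly_drawable_def weak_drawing_def by (meson subsetD)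
next
  fix V :: "'a set" and E u v
  assume G: "simple_graph V E" "{u, v} \<in> E" and "weakly_drawable V E"
  then obtain q S where W: "weak_drawing E q S" unfolding weakly_drawable_def by blast
  note uv = simple_graph_edgeD[OF G]
  \<comment> \<open>For a new edge \<open>e = ux\<close>, the term \<open>insert v (e - {u})\<close>
    recovers the original edge \<open>vx\<close>.\<close>
  define S' where "S' e = (if e \<in> E then S e else S {u, v} \<union> S (insert v (e - {u})))" for e
  have new: "u \<in> e \<and> v \<notin> e \<and> insert v (e - {u}) \<in> E" if e: "e \<in> contract u v E" "e \<notin> E" for e
  proof -
    obtain x where x: "x \<in> nbrs E v" "x \<noteq> u" "e = {u, x}" using e unfolding contract_def by auto
    then have "{v, x} \<in> E" "v \<noteq> x" using simple_graph_edgeD(3)[OF G(1), of v x] by (auto simp: nbrs_def)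
    moreover have "insert v (e - {u}) = {v, x}" using x by auto
    ultimately show ?thesis using x uv by auto
  qed
  have old: "v \<notin> e" if e: "e \<in> contract u v E" for e
    using simple_graph_card_edge(2)[OF simple_graph_contract[OF G] e] by auto
  have dis: "S e \<inter> S f = {}" if "e \<in> E" "f \<in> E" "e \<inter> f = {}" for e f
    using W that unfolding weak_drawing_def by simp
  have pc: "path_connected (S e)" "q ` e \<subseteq> S e" if "e \<in> E" for e
    using W that unfolding weak_drawing_def by auto
  have "weak_drawing (contract u v E) q S'"
    unfolding weak_drawing_def
  proof (intro conjI ballI impI)
    fix e assume e: "e \<in> contract u v E"
    show "path_connected (S' e)"
    proof (cases "e \<in> E")
      case False
      then have "q v \<in> S {u, v} \<inter> S (insert v (e - {u}))"
        using pc(2)[OF G(2)] pc(2)[of "insert v (e - {u})"] new[OF e] by auto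
      then show ?thesis using False pc(1)[OF G(2)] pc(1)[of "insert v (e - {u})"] new[OF e]
        unfolding S'_def by (auto intro!: path_connected_Un)
    qed (simp add: S'_def pc)
    show "q ` e \<subseteq> S' e"
    proof (cases "e \<in> E")
      case False
      then show ?thesis using pc(2)[OF G(2)] pc(2)[of "insert v (e - {u})"] new[OF e]
        unfolding S'_def by auto
    qed (simp add: S'_def pc)
  next
    fix e f assume ef: "e \<in> contract u v E" "f \<in> contract u v E" "e \<inter> f = {}"
    have mixed: "S' e \<inter> S' f = {}"
      if "e \<in> contract u v E" "f \<in> contract u v E" "e \<inter> f = {}" "e \<notin> E" "f \<in> E" for e f
    proof -
      have "{u, v} \<inter> f = {}" "insert v (e - {u}) \<inter> f = {}"
        using new[of e] old[of f] that by auto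
      then have "S {u, v} \<inter> S f = {}" "S (insert v (e - {u})) \<inter> S f = {}"
        using new[of e] that G(2) dis by simp_all
      then show ?thesis using that by (auto simp: S'_def)
    qed
    consider "e \<in> E" "f \<in> E" | "e \<notin> E" "f \<in> E" | "e \<in> E" "f \<notin> E" | "e \<notin> E" "f \<notin> E" by blast
    then show "S' e \<inter> S' f = {}"
    proof cases
      case 1 then show ?thesis using dis ef by (simp add: S'_def)
    next
      case 2 then show ?thesis using mixed ef by blast
    next
      case 3 then show ?thesis using mixed[of f e] ef by (simp add: Int_commute)
    next
      case 4 then show ?thesis using new ef by blast
    qed
  qed
  then show "weakly_drawable (V - {v}) (contract u v E)" unfolding weakly_drawable_def by blast
qed

text \<open>
  This is Mader's bound \<open>|E| \<le> s|V| - s(s + 1)/2\<close> for graphs without a \<open>K\<close>-minor on \<open>s + 2\<close> vertices,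
  doubled to avoid division and subtraction.
\<close>

definition edge_bound :: "nat \<Rightarrow> ('b set \<Rightarrow> 'b set set \<Rightarrow> bool) \<Rightarrow> bool" where
  "edge_bound s P \<longleftrightarrow> (\<forall>V E. simple_graph V E \<and> P V E \<and> s \<le> card V \<longrightarrow>
      2 * card E + s * (s + 1) \<le> 2 * s * card V)"

lemma card_edges_le:
  assumes "simple_graph V E"
  shows "2 * card E \<le> card V * (card V - 1)"
proof -
  have "2 * card E = (\<Sum>x\<in>V. card (nbrs E x))"
    using sum_degrees_eq[OF assms] card_nbrs[OF assms] by simp
  also have "\<dots> \<le> (\<Sum>x\<in>V. card V - 1)"
  proof (rule sum_mono)
    fix x assume "x \<in> V"
    have "card (nbrs E x) \<le> card (V - {x})"
      using nbrs_subset[OF assms] simple_graph_finite(1)[OF assms] by (intro card_mono) auto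
    then show "card (nbrs E x) \<le> card V - 1" using \<open>x \<in> V\<close> by simp
  qed
  finally show ?thesis by simp
qed

text \<open>
  If every edge lies in many triangles, then neighbourhoods have large minimum degree. By the bound
  for the cone class this is contradictory unless \<open>s = 2\<close>, where it forces minimum degree \<open>6\<close>.
\<close>

lemma local_edge_bound:
  assumes "minor_closed P" and b: "edge_bound s (cone_class z P)" and s: "s \<le> 2"
    and G: "simple_graph V E" "P V E"
    and t: "\<And>u v. {u, v} \<in> E \<Longrightarrow> Suc s \<le> card (nbrs E u \<inter> nbrs E v)"
    and ne: "nbrs E z \<noteq> {}"
  shows "s = 2 \<and> 6 \<le> card (nbrs E z)"
proof -
  let ?N = "nbrs E z"
  let ?F = "{e\<in>E. e \<subseteq> ?N}"
  note finN = finite_nbrs[OF G(1), of z]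
  have zN: "z \<notin> ?N" using nbrs_subset[OF G(1)] by blast
  have zV: "z \<in> V" using ne simple_graph_edgeD(1)[OF G(1)] by (auto simp: nbrs_def)
  have F: "simple_graph ?N ?F"
    using nbrs_subset[OF G(1), of z] by (intro simple_graph_subgraph[OF G(1)]) auto
  \<comment> \<open>The vertex \<open>z\<close> is itself the apex of a cone over its neighbourhood
    inside the graph.\<close>
  have "P (insert z ?N) (cone_edges z ?N ?F)"
    by (rule minor_closed_subgraph[OF assms(1) G])
       (use zV nbrs_subset[OF G(1), of z] simple_graph_cone[OF F zN] in \<open>auto simp: cone_edges_def nbrs_def\<close>)
  then have cone: "cone_class z P ?N ?F" using zN by (simp add: cone_class_def)
  obtain y where y: "y \<in> ?N" using ne by blast
  have deg: "Suc s \<le> card (nbrs ?F x)" if "x \<in> ?N" for x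
  proof -
    have "nbrs E z \<inter> nbrs E x \<subseteq> nbrs ?F x" using that by (auto simp: nbrs_def)
    then have "card (nbrs E z \<inter> nbrs E x) \<le> card (nbrs ?F x)"
      using finite_nbrs[OF F] by (rule card_mono[rotated])
    then show ?thesis using t[of z x] that by (simp add: nbrs_def)
  qed
  have "card ?N * Suc s \<le> (\<Sum>x\<in>?N. card (nbrs ?F x))"
    using sum_mono[of ?N "\<lambda>_. Suc s" "\<lambda>x. card (nbrs ?F x)"] deg by simp
  then have low: "card ?N * Suc s \<le> 2 * card ?F"
    using sum_degrees_eq[OF F] card_nbrs[OF F] by simp
  have "Suc s \<le> card ?N"
    using deg[OF y] card_mono[OF finN, of "nbrs ?F y"] nbrs_subset[OF F, of y] by fastforce
  then have up: "2 * card ?F + s * (s + 1) \<le> 2 * s * card ?N"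
    using b F cone unfolding edge_bound_def by simp
  \<comment> \<open>Together \<open>low\<close> and \<open>up\<close> say
    \<open>s * (s + 1) \<le> (s - 1) * card ?N\<close> over the integers: impossible for
    \<open>s \<le> 1\<close>, and \<open>6 \<le> card ?N\<close> for \<open>s = 2\<close>.\<close>
  have "s = 0 \<or> s = 1 \<or> s = 2" using s by auto
  then show ?thesis using low up \<open>Suc s \<le> card ?N\<close> by auto
qed

text \<open>Mader's induction on the number of vertices. A counterexample trimmed to one edge above
  the bound has no isolated vertex, and each of its edges lies in at least \<open>Suc s\<close>
  triangles, since otherwise a deletion or contraction gives a smaller counterexample. Then
  \<open>local_edge_bound\<close> applies.\<close>

lemma edge_bound_Suc:
  assumes mc: "minor_closed P" and b: "\<And>z. edge_bound s (cone_class z P)" and s: "s \<le> 2"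
  shows "edge_bound (Suc s) P"
proof -
  have "2 * card E + Suc s * (s + 2) \<le> 2 * Suc s * card V"
    if "simple_graph V E" "P V E" "Suc s \<le> card V" for V E
    using that
  proof (induction "card V" arbitrary: V E rule: less_induct)
    case less
    note G = less.prems(1,2)
    note fin = simple_graph_finite[OF G(1)]
    show ?case
    proof (cases "card V = Suc s")
      case True
      \<comment> \<open>On \<open>Suc s\<close> vertices the complete graph attains the
        bound.\<close>
      then show ?thesis using card_edges_le[OF G(1)] by (simp add: algebra_simps)
    next
      case False
      then have big: "Suc s < card V" using less.prems by simp
      show ?thesis
      proof (rule ccontr)
        assume no: "\<not> ?thesis"
        \<comment> \<open>The number \<open>m\<close> is the allowed number of edges plus one, an
          integer because \<open>Suc s * (s + 2)\<close> is even.\<close>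
        have "\<exists>m. 2 * m + Suc s * (s + 2) = 2 * Suc s * card V + 2"
        proof -
          have "even (Suc s * (s + 2))" by simp
          then obtain h where h: "Suc s * (s + 2) = 2 * h" by (elim evenE)
          have "Suc s * (s + 2) \<le> Suc s * card V" using big by (intro mult_left_mono) auto
          then have "h \<le> Suc s * card V + 1" using h by linarith
          then have "2 * (Suc s * card V + 1 - h) + Suc s * (s + 2) = 2 * Suc s * card V + 2"
            using h by (simp add: algebra_simps)
          then show ?thesis by blast
        qed
        then obtain m where m: "2 * m + Suc s * (s + 2) = 2 * Suc s * card V + 2" by blast
        have "m \<le> card E"
        proof -
          have "even (Suc s * (s + 2))" by simp
          then obtain h where "Suc s * (s + 2) = 2 * h" by (elim evenE)
          then show ?thesis using m no by (simp add: algebra_simps)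
        qed
        then obtain F where F: "F \<subseteq> E" "card F = m"
          using obtain_subset_with_card_n by blast
        have GF: "simple_graph V F" using F simple_graph_card_edge[OF G(1)]
          by (intro simple_graph_subgraph[OF G(1)]) auto
        have PF: "P V F" using minor_closed_subgraph[OF mc G _ F(1) GF] by simp
        \<comment> \<open>Losing a vertex lowers the bound by \<open>Suc s\<close>, so a loss of at
          most \<open>Suc s\<close> edges keeps it violated.\<close>
        have smaller: False
          if "simple_graph V' E'" "P V' E'" "card V' + 1 = card V" "m \<le> card E' + Suc s" for V' E'
        proof -
          have "2 * card E' + Suc s * (s + 2) \<le> 2 * Suc s * card V'"
            using that big by (intro less.hyps) auto
          moreover have "2 * Suc s * card V = 2 * Suc s * card V' + 2 * Suc s"
            using that(3) by (metis distrib_left mult.right_neutral)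
          moreover note m that(4)
          moreover define a b c where "a = Suc s * (s + 2)" and "b = 2 * Suc s * card V'" and "c = Suc s"
          ultimately have "2 * card E' + a \<le> b" "2 * m + a = b + 2 * c + 2" "m \<le> card E' + c"
            by simp_all
          then show False by linarith
        qed
        have t: "Suc s \<le> card (nbrs F u \<inter> nbrs F v)" if uv: "{u, v} \<in> F" for u v
        proof (rule ccontr)
          assume "\<not> ?thesis"
          then have "m \<le> card (contract u v F) + Suc s"
            using card_contract[OF GF uv] F(2) by linarith
          moreover have "card (V - {v}) + 1 = card V"
            using simple_graph_edgeD(2)[OF GF uv] fin(1) by (metis Suc_eq_plus1 card_Suc_Diff1)
          ultimately show False
            using smaller[OF simple_graph_contract[OF GF uv] minor_closed_contract[OF mc GF PF uv]] by blast
        qed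
        have ne: "nbrs F z \<noteq> {}" if z: "z \<in> V" for z
        proof
          assume "nbrs F z = {}"
          then have "{e\<in>F. z \<in> e} = {}"
            using card_nbrs[OF GF, of z] simple_graph_finite(2)[OF GF] by simp
          then have GF': "simple_graph (V - {z}) F"
            using simple_graph_card_edge(2)[OF GF] by (intro simple_graph_subgraph[OF GF]) blast+
          show False
          proof (rule smaller[OF GF'])
            show "P (V - {z}) F" using minor_closed_subgraph[OF mc GF PF _ _ GF'] by blast
            show "card (V - {z}) + 1 = card V" using z fin(1) by (metis Suc_eq_plus1 card_Suc_Diff1)
          qed (use F in simp)
        qed
        have deg: "s = 2 \<and> 6 \<le> card (nbrs F z)" if "z \<in> V" for z
          using local_edge_bound[OF mc b s GF PF t ne[OF that]] .
        \<comment> \<open>Minimum degree 6 gives \<open>6 * card V \<le> 2 * m\<close>, whereas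
          \<open>2 * m = 6 * card V - 10\<close> for \<open>s = 2\<close>. This is why the edge set
          was trimmed.\<close>
        then have "(\<Sum>z\<in>V. 6) \<le> (\<Sum>z\<in>V. card (nbrs F z))"
          by (intro sum_mono) blast
        then have "6 * card V \<le> 2 * m"
          using sum_degrees_eq[OF GF] card_nbrs[OF GF] F(2) by (simp add: mult.commute)
        moreover have "V \<noteq> {}" using big by auto
        then have "s = 2" using deg by blast
        ultimately show False using m by simp
      qed
    qed
  qed
  then show ?thesis unfolding edge_bound_def by (simp add: algebra_simps)
qed
text \<open>An edge together with three apices would span a \<open>K\<^sub>5\<close>, so there is no
  edge at all.\<close>

lemma edge_bound_0_triple_cone:
  "edge_bound 0 (cone_class z3 (cone_class z2 (cone_class z1 weakly_drawable)))"
  unfolding edge_bound_def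
proof (intro allI impI; elim conjE)
  fix V :: "'a set" and E
  assume G: "simple_graph V E"
    and P: "cone_class z3 (cone_class z2 (cone_class z1 weakly_drawable)) V E"
  let ?K = "cone_edges z1 (insert z2 (insert z3 V)) (cone_edges z2 (insert z3 V) (cone_edges z3 V E))"
  have z: "z3 \<notin> V" "z2 \<notin> insert z3 V" "z1 \<notin> insert z2 (insert z3 V)"
    and W: "weakly_drawable (insert z1 (insert z2 (insert z3 V))) ?K"
    using P by (simp_all add: cone_class_def)
  have "E = {}"
  proof (rule ccontr)
    assume "E \<noteq> {}"
    then obtain e where "e \<in> E" by blast
    then obtain a b where ab: "a \<in> V" "b \<in> V" "a \<noteq> b" "e = {a, b}"
      using simple_graph_edgeE[OF G] by metis
    define v where "v i = [z1, z2, z3, a, b] ! (i - 1)" for i :: nat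
    have v: "v 1 = z1" "v 2 = z2" "v 3 = z3" "v 4 = a" "v 5 = b"
      by (simp_all add: v_def numeral_eq_Suc)
    have five: "{1..5} = {1, 2, 3, 4, 5::nat}" by auto
    have "\<not> weakly_drawable (insert z1 (insert z2 (insert z3 V))) ?K"
    proof (rule K5_not_weakly_drawable)
      show "inj_on v {1..5}" unfolding five using z ab v by (auto simp: inj_on_def)
      have K: "{z1, z2} \<in> ?K" "{z1, z3} \<in> ?K" "{z1, a} \<in> ?K" "{z1, b} \<in> ?K" "{z2, z3} \<in> ?K"
        "{z2, a} \<in> ?K" "{z2, b} \<in> ?K" "{z3, a} \<in> ?K" "{z3, b} \<in> ?K" "{a, b} \<in> ?K"
        using ab \<open>e \<in> E\<close> by (simp_all add: cone_edges_def)
      fix i j :: nat assume "i \<in> {1..5}" "j \<in> {1..5}" "i < j"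
      then have "1 \<le> i" "i < j" "j \<le> 5" by simp_all
      then have "i = 1 \<and> (j = 2 \<or> j = 3 \<or> j = 4 \<or> j = 5) \<or> i = 2 \<and> (j = 3 \<or> j = 4 \<or> j = 5) \<or>
          i = 3 \<and> (j = 4 \<or> j = 5) \<or> i = 4 \<and> j = 5"
        by presburger
      then show "{v i, v j} \<in> ?K" by (elim conjE disjE) (simp_all only: v K)
    qed
    then show False using W by blast
  qed
  then show "2 * card E + 0 * (0 + 1) \<le> 2 * 0 * card V" by simp
qed

text \<open>Each use of \<open>edge_bound_Suc\<close> strips one of the three cones and raises
  \<open>s\<close> by one. This ends with \<open>3 * card V - 6\<close> for at least three vertices;
  smaller graphs obey the trivial bound.\<close>

lemma weakly_drawable_card_edges:
  assumes "simple_graph V E" "weakly_drawable V E"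
  shows "card E \<le> 3 * card V"
proof -
  note mc = minor_closed_cone_class minor_closed_weakly_drawable
  have "edge_bound (Suc 0) (cone_class z2 (cone_class z1 weakly_drawable))" for z1 z2 :: 'a
    by (rule edge_bound_Suc[OF _ edge_bound_0_triple_cone]) (simp_all add: mc)
  then have "edge_bound (Suc (Suc 0)) (cone_class z1 weakly_drawable)" for z1 :: 'a
    by (rule edge_bound_Suc[rotated]) (simp_all add: mc)
  then have bound: "edge_bound (Suc (Suc (Suc 0))) (weakly_drawable :: 'a set \<Rightarrow> _)"
    by (rule edge_bound_Suc[rotated]) (simp_all add: mc)
  show ?thesis
  proof (cases "3 \<le> card V")
    case True
    then have "2 * card E + 3 * 4 \<le> 2 * 3 * card V"
      using bound assms unfolding edge_bound_def by (simp add: eval_nat_numeral)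
    then show ?thesis by simp
  next
    case False
    then have "card V = 0 \<or> card V = 1 \<or> card V = 2" by auto
    then show ?thesis using card_edges_le[OF assms(1)] by auto
  qed
qed

section \<open>Sampling the vertices of a shallow minor\<close>

text \<open>If every element of \<open>V\<close> is kept independently with probability
  \<open>p\<close>, this is the probability that all of \<open>A\<close> and nothing of
  \<open>B\<close> is kept.\<close>

lemma sum_subset_weights:
  fixes p :: real
  assumes "finite V" "A \<subseteq> V" "B \<subseteq> V" "A \<inter> B = {}"
  shows "(\<Sum>S\<in>Pow V. if A \<subseteq> S \<and> B \<inter> S = {} then p ^ card S * (1 - p) ^ card (V - S) else 0)
       = p ^ card A * (1 - p) ^ card B"
proof -
  \<comment> \<open>The weights of keeping and of dropping \<open>x\<close>, set to 0 where that is
    forbidden. Expanding the product of \<open>?f x + ?g x\<close> over \<open>V\<close> yields the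
    sum over subsets.\<close>
  let ?f = "\<lambda>x. if x \<in> B then 0 else p" and ?g = "\<lambda>x. if x \<in> A then 0 else 1 - p"
  have "(if A \<subseteq> S \<and> B \<inter> S = {} then p ^ card S * (1 - p) ^ card (V - S) else 0)
      = (\<Prod>x\<in>S. ?f x) * (\<Prod>x\<in>V - S. ?g x)" if "S \<in> Pow V" for S
  proof -
    have fin: "finite S" "finite (V - S)" using assms that finite_subset by auto
    have "(\<Prod>x\<in>S. ?f x) = (if B \<inter> S = {} then p ^ card S else 0)"
    proof (cases "B \<inter> S = {}")
      case True
      then have "(\<Prod>x\<in>S. ?f x) = (\<Prod>x\<in>S. p)" by (intro prod.cong) auto
      then show ?thesis using True by simp
    next
      case False
      then show ?thesis using fin by (auto simp: prod_zero_iff)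
    qed
    moreover have "(\<Prod>x\<in>V - S. ?g x) = (if A \<subseteq> S then (1 - p) ^ card (V - S) else 0)"
    proof (cases "A \<subseteq> S")
      case True
      then have "(\<Prod>x\<in>V - S. ?g x) = (\<Prod>x\<in>V - S. 1 - p)" by (intro prod.cong) auto
      then show ?thesis using True by simp
    next
      case False
      then have "\<exists>x\<in>V - S. ?g x = 0" using assms(2) by auto
      then show ?thesis using fin False by (simp add: prod_zero)
    qed
    ultimately show ?thesis by simp
  qed
  then have "(\<Sum>S\<in>Pow V. if A \<subseteq> S \<and> B \<inter> S = {} then p ^ card S * (1 - p) ^ card (V - S) else 0)
     = (\<Prod>x\<in>V. ?f x + ?g x)"
    unfolding prod_add[OF assms(1)] by (rule sum.cong[OF refl])
  also have "\<dots> = (\<Prod>x\<in>V. (if x \<in> A then p else 1) * (if x \<in> B then 1 - p else 1))"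
    using assms(4) by (intro prod.cong) auto
  also have "\<dots> = p ^ card A * (1 - p) ^ card B"
    using assms by (simp add: prod.distrib prod.If_cases Int_absorb1)
  finally show ?thesis .
qed

text \<open>Linearity of expectation: the left side is at most the expected number of surviving
  edges, and the right side is \<open>c\<close> times the expected number of kept vertices.\<close>

lemma conflict_free_sampling:
  fixes p :: real
  assumes G: "simple_graph V E" and p: "0 \<le> p" "p \<le> 1"
    and C: "\<And>e. e \<in> E \<Longrightarrow> C e \<subseteq> V - e" "\<And>e. e \<in> E \<Longrightarrow> card (C e) \<le> D"
    and bound: "\<And>S. S \<subseteq> V \<Longrightarrow> card {e\<in>E. e \<subseteq> S \<and> C e \<inter> S = {}} \<le> c * card S"
  shows "card E * (p\<^sup>2 * (1 - p) ^ D) \<le> c * (p * card V)"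
proof -
  note fin = simple_graph_finite[OF G]
  define w where "w S = p ^ card S * (1 - p) ^ card (V - S)" for S
  have w: "0 \<le> w S" for S using p by (simp add: w_def)
  have "card E * (p\<^sup>2 * (1 - p) ^ D) = (\<Sum>e\<in>E. p\<^sup>2 * (1 - p) ^ D)" by simp
  also have "\<dots> \<le> (\<Sum>e\<in>E. p ^ card e * (1 - p) ^ card (C e))"
  proof (rule sum_mono)
    fix e assume e: "e \<in> E"
    have "(1 - p) ^ D \<le> (1 - p) ^ card (C e)" using p C(2)[OF e] by (intro power_decreasing) auto
    then show "p\<^sup>2 * (1 - p) ^ D \<le> p ^ card e * (1 - p) ^ card (C e)"
      unfolding simple_graph_card_edge(1)[OF G e] by (intro mult_left_mono) auto
  qed
  also have "\<dots> = (\<Sum>e\<in>E. \<Sum>S\<in>Pow V. if e \<subseteq> S \<and> C e \<inter> S = {} then w S else 0)"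
  proof (rule sum.cong[OF refl])
    fix e assume e: "e \<in> E"
    have "e \<subseteq> V" "C e \<subseteq> V" "e \<inter> C e = {}"
      using C(1)[OF e] simple_graph_card_edge(2)[OF G e] by auto
    from sum_subset_weights[OF fin(1) this, of p]
    show "p ^ card e * (1 - p) ^ card (C e) = (\<Sum>S\<in>Pow V. if e \<subseteq> S \<and> C e \<inter> S = {} then w S else 0)"
      by (simp only: w_def)
  qed
  also have "\<dots> = (\<Sum>S\<in>Pow V. \<Sum>e\<in>E. if e \<subseteq> S \<and> C e \<inter> S = {} then w S else 0)"
    by (rule sum.swap)
  also have "\<dots> = (\<Sum>S\<in>Pow V. w S * card {e\<in>E. e \<subseteq> S \<and> C e \<inter> S = {}})"
    using fin by (simp add: sum.If_cases Int_def mult.commute)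
  also have "\<dots> \<le> (\<Sum>S\<in>Pow V. w S * (c * card S))"
  proof (intro sum_mono mult_left_mono w)
    fix S assume "S \<in> Pow V"
    then have "card {e\<in>E. e \<subseteq> S \<and> C e \<inter> S = {}} \<le> c * card S" by (intro bound) simp
    then have "real (card {e\<in>E. e \<subseteq> S \<and> C e \<inter> S = {}}) \<le> real (c * card S)" by (rule of_nat_mono)
    then show "real (card {e\<in>E. e \<subseteq> S \<and> C e \<inter> S = {}}) \<le> c * card S" by simp
  qed
  also have "\<dots> = c * (\<Sum>S\<in>Pow V. \<Sum>x\<in>V. if x \<in> S then w S else 0)"
  proof -
    have "w S * (c * card S) = c * (\<Sum>x\<in>V. if x \<in> S then w S else 0)" if "S \<in> Pow V" for S
    proof -
      have "(\<Sum>x\<in>V. if x \<in> S then w S else 0) = (\<Sum>x\<in>V \<inter> S. w S)"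
        by (rule sum.inter_restrict[OF fin(1), symmetric])
      also have "V \<inter> S = S" using that by auto
      finally show ?thesis by simp
    qed
    then have "(\<Sum>S\<in>Pow V. w S * (c * card S))
        = (\<Sum>S\<in>Pow V. c * (\<Sum>x\<in>V. if x \<in> S then w S else 0))"
      by (rule sum.cong[OF refl])
    also have "\<dots> = c * (\<Sum>S\<in>Pow V. \<Sum>x\<in>V. if x \<in> S then w S else 0)"
      by (rule sum_distrib_left[symmetric])
    finally show ?thesis .
  qed
  also have "(\<Sum>S\<in>Pow V. \<Sum>x\<in>V. if x \<in> S then w S else 0)
           = (\<Sum>x\<in>V. \<Sum>S\<in>Pow V. if x \<in> S then w S else 0)"
    by (rule sum.swap)
  also have "\<dots> = (\<Sum>x\<in>V. p)"
  proof (rule sum.cong[OF refl])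
    fix x assume "x \<in> V"
    then show "(\<Sum>S\<in>Pow V. if x \<in> S then w S else 0) = p"
      using sum_subset_weights[OF fin(1), of "{x}" "{}" p] unfolding w_def by simp
  qed
  finally show ?thesis by (simp add: mult.commute)
qed

lemma conflict_free_card_edges:
  assumes G: "simple_graph V E"
    and C: "\<And>e. e \<in> E \<Longrightarrow> C e \<subseteq> V - e" "\<And>e. e \<in> E \<Longrightarrow> card (C e) \<le> D"
    and bound: "\<And>S. S \<subseteq> V \<Longrightarrow> card {e\<in>E. e \<subseteq> S \<and> C e \<inter> S = {}} \<le> c * card S"
  shows "card E \<le> 3 * c * (D + 1) * card V"
proof -
  define p :: real where "p = 1 / (D + 1)"
  have p: "0 < p" "p \<le> 1" by (auto simp: p_def)
  have three: "1 \<le> 3 * (1 - p) ^ D"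
  proof (cases "D = 0")
    case False
    \<comment> \<open>For \<open>p = 1 / (D + 1)\<close> the reciprocal of
      \<open>(1 - p) ^ D\<close> is \<open>(1 + 1 / D) ^ D\<close>, which is at most
      \<open>exp 1\<close>.\<close>
    have "(1 + 1 / real D) ^ D \<le> exp 1" by (rule exp_ge_one_plus_x_over_n_power_n) (use False in auto)
    also have "\<dots> \<le> 3" by (rule exp_le)
    finally have "(1 + 1 / real D) ^ D * (1 - p) ^ D \<le> 3 * (1 - p) ^ D"
      using p by (intro mult_right_mono) auto
    moreover have "1 + 1 / real D = (D + 1) / D" "1 - p = D / (D + 1)"
      using False by (simp_all add: p_def field_simps)
    then have "(1 + 1 / real D) * (1 - p) = 1" using False by simp
    then have "(1 + 1 / real D) ^ D * (1 - p) ^ D = 1" by (metis power_mult_distrib power_one)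
    ultimately show ?thesis by simp
  qed simp
  have "card E * (p\<^sup>2 * (1 - p) ^ D) \<le> c * (p * card V)"
    using p by (intro conflict_free_sampling[OF G _ _ C bound]) auto
  then have "p * (card E * p * (1 - p) ^ D) \<le> p * (c * card V)"
    by (simp add: power2_eq_square algebra_simps)
  then have le: "card E * p * (1 - p) ^ D \<le> c * card V" using p(1) by (rule mult_left_le_imp_le)
  have "card E * p * 1 \<le> card E * p * (3 * (1 - p) ^ D)"
    using p three by (intro mult_left_mono) auto
  also have "\<dots> \<le> 3 * (c * card V)" using le by simp
  finally have "real (card E) \<le> 3 * (c * card V) * (D + 1)"
    by (simp add: p_def field_simps)
  then have "real (card E) \<le> real (3 * c * (D + 1) * card V)" by (simp add: algebra_simps)
  then show ?thesis by (simp only: of_nat_le_iff)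
qed

section \<open>Routing the edges of a shallow minor through a drawing\<close>

lemma path_image_eq_curve_interior:
  "path_image g = insert (pathstart g) (insert (pathfinish g) (curve_interior g))"
proof -
  have "{0..1::real} = insert 0 (insert 1 {0<..<1})" by auto
  then show ?thesis by (simp add: path_image_def curve_interior_def pathstart_def pathfinish_def)
qed

lemma drawing_edge:
  assumes "drawing V E p \<gamma>" "a \<in> E"
  shows "path_connected (path_image (\<gamma> a))" "p ` a \<subseteq> path_image (\<gamma> a)"
    "path_image (\<gamma> a) = p ` a \<union> curve_interior (\<gamma> a)"
proof -
  have arc: "arc (\<gamma> a)" and ends: "{pathstart (\<gamma> a), pathfinish (\<gamma> a)} = p ` a"
    using assms by (simp_all add: drawing_def)
  show "path_connected (path_image (\<gamma> a))"
    using arc by (simp add: arc_imp_path path_connected_path_image)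
  show eq: "path_image (\<gamma> a) = p ` a \<union> curve_interior (\<gamma> a)"
    unfolding ends[symmetric] path_image_eq_curve_interior by simp
  show "p ` a \<subseteq> path_image (\<gamma> a)" unfolding eq by simp
qed

text \<open>The curves along a walk are joined one by one. The set \<open>A\<close> of edges used is
  recorded, because the charged crossings are counted per edge.\<close>

lemma reach_path_connected_set:
  assumes D: "drawing V E p \<gamma>" and sub: "F \<subseteq> E" "\<And>a. a \<in> F \<Longrightarrow> a \<subseteq> W" and c: "c \<in> W"
  shows "reach F n c w \<Longrightarrow> \<exists>A T. A \<subseteq> F \<and> finite A \<and> card A \<le> n \<and> path_connected T \<and>
     p c \<in> T \<and> p w \<in> T \<and> T \<subseteq> p ` W \<union> (\<Union>a\<in>A. curve_interior (\<gamma> a))"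
proof (induction n arbitrary: w)
  case 0
  then show ?case using c by (intro exI[of _ "{}"] exI[of _ "{p c}"]) auto
next
  case (Suc n)
  show ?case
  proof (cases "reach F n c w")
    case True
    from Suc.IH[OF True] show ?thesis by (metis le_SucI)
  next
    case False
    then obtain u where u: "reach F n c u" "{u, w} \<in> F" using Suc.prems by auto
    from Suc.IH[OF u(1)] obtain A T where A: "A \<subseteq> F" "finite A" "card A \<le> n"
      and T: "path_connected T" "p c \<in> T" "p u \<in> T" "T \<subseteq> p ` W \<union> (\<Union>a\<in>A. curve_interior (\<gamma> a))"
      by blast
    have uE: "{u, w} \<in> E" using u sub by blast
    note e = drawing_edge[OF D uE]
    let ?A = "insert {u, w} A" and ?T = "T \<union> path_image (\<gamma> {u, w})"
    have "?A \<subseteq> F" "finite ?A" "card ?A \<le> Suc n" using A u by (auto simp: card_insert_if)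
    moreover have "path_connected ?T" using T e by (intro path_connected_Un) auto
    moreover have "p c \<in> ?T" "p w \<in> ?T" using T e by auto
    moreover have "?T \<subseteq> p ` W \<union> (\<Union>a\<in>?A. curve_interior (\<gamma> a))"
      using T(4) e(3) sub(2)[OF u(2)] by auto
    ultimately show ?thesis by blast
  qed
qed

text \<open>At most \<open>r\<close> edges lead from one centre to an edge \<open>ab\<close> joining
  the branch sets, and at most \<open>r\<close> from there to the other centre.\<close>

lemma shallow_model_edge_route:
  assumes D: "drawing V E p \<gamma>"
    and M: "shallow_model r VH EH V E mu" and H: "simple_graph VH EH"
    and c: "\<And>v. v \<in> VH \<Longrightarrow> c v \<in> fst (mu v) \<and> (\<forall>w\<in>fst (mu v). reach (snd (mu v)) r (c v) w)"
    and e: "e \<in> EH"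
  shows "\<exists>A T. A \<subseteq> E \<and> finite A \<and> card A \<le> 2 * r + 1 \<and> (\<forall>a\<in>A. a \<subseteq> (\<Union>x\<in>e. fst (mu x))) \<and>
     path_connected T \<and> (\<forall>x\<in>e. p (c x) \<in> T) \<and>
     T \<subseteq> p ` (\<Union>x\<in>e. fst (mu x)) \<union> (\<Union>a\<in>A. curve_interior (\<gamma> a))"
proof -
  obtain v w where vw: "v \<in> VH" "w \<in> VH" "v \<noteq> w" "e = {v, w}"
    using simple_graph_edgeE[OF H e] by metis
  have sub: "snd (mu x) \<subseteq> E" "\<And>a. a \<in> snd (mu x) \<Longrightarrow> a \<subseteq> fst (mu x)" if "x \<in> VH" for x
    using M that unfolding shallow_model_def is_subgraph_def by blast+
  obtain a b where ab: "a \<in> fst (mu v)" "b \<in> fst (mu w)" "{a, b} \<in> E"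
    using M e vw unfolding shallow_model_def by blast
  have r1: "reach (snd (mu v)) r (c v) a" and r2: "reach (snd (mu w)) r (c w) b"
    using c vw ab by auto
  obtain A1 T1 where
    1: "A1 \<subseteq> snd (mu v)" "finite A1" "card A1 \<le> r" "path_connected T1" "p (c v) \<in> T1" "p a \<in> T1"
      "T1 \<subseteq> p ` fst (mu v) \<union> (\<Union>a\<in>A1. curve_interior (\<gamma> a))"
    using reach_path_connected_set[OF D sub[OF vw(1)] conjunct1[OF c[OF vw(1)]] r1] by auto
  obtain A2 T2 where
    2: "A2 \<subseteq> snd (mu w)" "finite A2" "card A2 \<le> r" "path_connected T2" "p (c w) \<in> T2" "p b \<in> T2"
      "T2 \<subseteq> p ` fst (mu w) \<union> (\<Union>a\<in>A2. curve_interior (\<gamma> a))"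
    using reach_path_connected_set[OF D sub[OF vw(2)] conjunct1[OF c[OF vw(2)]] r2] by auto
  note ed = drawing_edge[OF D ab(3)]
  let ?A = "insert {a, b} (A1 \<union> A2)" and ?T = "T1 \<union> path_image (\<gamma> {a, b}) \<union> T2"
  have "?A \<subseteq> E" "finite ?A" using 1(1,2) 2(1,2) sub(1)[OF vw(1)] sub(1)[OF vw(2)] ab(3) by auto
  moreover have "card ?A \<le> 2 * r + 1"
    using card_Un_le[of A1 A2] 1 2 by (simp add: card_insert_if)
  moreover have "\<forall>a\<in>?A. a \<subseteq> (\<Union>x\<in>e. fst (mu x))"
  proof
    fix a' assume "a' \<in> ?A"
    then consider "a' = {a, b}" | "a' \<in> snd (mu v)" | "a' \<in> snd (mu w)" using 1(1) 2(1) by blast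
    then show "a' \<subseteq> (\<Union>x\<in>e. fst (mu x))"
      by cases (use ab vw(4) sub(2)[OF vw(1)] sub(2)[OF vw(2)] in \<open>auto dest: subsetD\<close>)
  qed
  moreover have "path_connected ?T"
    using 1 2 ed by (intro path_connected_Un) auto
  moreover have "\<forall>x\<in>e. p (c x) \<in> ?T" using 1 2 vw by auto
  moreover have "?T \<subseteq> p ` (\<Union>x\<in>e. fst (mu x)) \<union> (\<Union>a\<in>?A. curve_interior (\<gamma> a))"
  proof -
    have "path_image (\<gamma> {a, b}) \<subseteq> p ` (\<Union>x\<in>e. fst (mu x)) \<union> curve_interior (\<gamma> {a, b})"
      unfolding ed(3) using ab vw by auto
    then show ?thesis using 1(7) 2(7) unfolding vw(4) by auto
  qed
  ultimately show ?thesis by blast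
qed

text \<open>Sampling is applied with \<open>D = k * (2 * r + 1)\<close> and \<open>c = 3\<close>,
  the latter from \<open>weakly_drawable_card_edges\<close>.\<close>

lemma shallow_minor_card_edges:
  assumes G: "simple_graph V E" and K: "k_gap_planar k V E"
    and H: "simple_graph VH EH" and "shallow_minor r VH EH V E"
  shows "card EH \<le> 9 * (k * (2 * r + 1) + 1) * card VH"
proof -
  obtain mu where M: "shallow_model r VH EH V E mu"
    using assms(4) unfolding shallow_minor_def by blast
  obtain p \<gamma> ch where D: "drawing V E p \<gamma>"
    and ch: "\<forall>x\<in>crossings E \<gamma>. ch x \<in> fst x"
    and chk: "\<forall>a\<in>E. finite {x\<in>crossings E \<gamma>. ch x = a} \<and> card {x\<in>crossings E \<gamma>. ch x = a} \<le> k"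
    using K unfolding k_gap_planar_def k_gap_planar_drawing_def by blast
  let ?B = "\<lambda>x. fst (mu x)"
  have bagV: "?B x \<subseteq> V" if "x \<in> VH" for x
    using M that unfolding shallow_model_def is_subgraph_def by blast
  have bags: "x = y" if "x \<in> VH" "y \<in> VH" "u \<in> ?B x" "u \<in> ?B y" for x y u
    using M that unfolding shallow_model_def by blast
  have "\<exists>z\<in>?B v. \<forall>w\<in>?B v. reach (snd (mu v)) r z w" if "v \<in> VH" for v
    using M that unfolding shallow_model_def radius_le_def by blast
  then obtain c where c: "\<And>v. v \<in> VH \<Longrightarrow> c v \<in> ?B v \<and> (\<forall>w\<in>?B v. reach (snd (mu v)) r (c v) w)"
    by metis
  define R where "R e A T \<longleftrightarrow>
      A \<subseteq> E \<and> finite A \<and> card A \<le> 2 * r + 1 \<and> (\<forall>a\<in>A. a \<subseteq> (\<Union>x\<in>e. ?B x)) \<and>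
      path_connected T \<and> (\<forall>x\<in>e. p (c x) \<in> T) \<and>
      T \<subseteq> p ` (\<Union>x\<in>e. ?B x) \<union> (\<Union>a\<in>A. curve_interior (\<gamma> a))" for e A T
  have "\<forall>e\<in>EH. \<exists>A T. R e A T"
    unfolding R_def by (intro ballI shallow_model_edge_route[OF D M H c])
  then obtain A T where "\<forall>e\<in>EH. R e (A e) (T e)" by metis
  then have R: "R e (A e) (T e)" if "e \<in> EH" for e using that by blast
  have A: "A e \<subseteq> E \<and> finite (A e) \<and> card (A e) \<le> 2 * r + 1"
    and Ab: "a \<in> A e \<Longrightarrow> a \<subseteq> (\<Union>x\<in>e. ?B x)"
    and T: "path_connected (T e) \<and> (\<forall>x\<in>e. p (c x) \<in> T e)"
    and Ts: "T e \<subseteq> p ` (\<Union>x\<in>e. ?B x) \<union> (\<Union>a\<in>A e. curve_interior (\<gamma> a))"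
    if "e \<in> EH" for e a
    using R[OF that] unfolding R_def by simp_all
  have eVH: "e \<subseteq> VH" if "e \<in> EH" for e using simple_graph_card_edge(2)[OF H that] .
  define Q where "Q e = {x\<in>crossings E \<gamma>. ch x \<in> A e}" for e
  \<comment> \<open>If a crossing charged to the route of \<open>e\<close> lies on the route of an independent edge \<open>f\<close>,
    then every candidate for this choice is an end of \<open>f\<close>; otherwise the choice may be junk,
    which the intersection in \<open>C\<close> removes.\<close>
  define cv where "cv e x = (SOME y. y \<in> VH - e \<and> \<Union>(fst x) \<inter> ?B y \<noteq> {})"
    for e and x :: "'a set set \<times> real \<times> real"
  define C where "C e = cv e ` Q e \<inter> (VH - e)" for e
  have Q: "finite (Q e) \<and> card (Q e) \<le> k * (2 * r + 1)" if e: "e \<in> EH" for e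
  proof -
    have Q: "Q e = (\<Union>a\<in>A e. {x\<in>crossings E \<gamma>. ch x = a})" unfolding Q_def by auto
    have "card (Q e) \<le> (\<Sum>a\<in>A e. card {x\<in>crossings E \<gamma>. ch x = a})"
      unfolding Q using A[OF e] by (intro card_UN_le) simp
    also have "\<dots> \<le> (\<Sum>a\<in>A e. k)" using A[OF e] chk by (intro sum_mono) blast
    also have "\<dots> \<le> k * (2 * r + 1)" using A[OF e] by (simp add: mult.commute[of _ k] del: mult_Suc_right)
    finally show ?thesis using A[OF e] chk unfolding Q by blast
  qed
  have conflict: "C e \<inter> f \<noteq> {}"
    if e: "e \<in> EH" and f: "f \<in> EH" and ef: "e \<inter> f = {}" and a: "a \<in> A e" and b: "b \<in> A f"
      and x: "x \<in> crossings E \<gamma>" "fst x = {a, b}" "ch x = a" for e f a b x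
  proof -
    \<comment> \<open>The ends of \<open>a\<close> and \<open>b\<close> lie in branch sets of ends
      of \<open>e\<close> and of \<open>f\<close>, and branch sets are disjoint.\<close>
    have only: "y \<in> f" if y: "y \<in> VH - e" "\<Union>(fst x) \<inter> ?B y \<noteq> {}" for y
    proof -
      obtain u where u: "u \<in> ?B y" "u \<in> a \<or> u \<in> b" using y(2) unfolding x(2) by auto
      then consider y' where "y' \<in> e" "u \<in> ?B y'" | y' where "y' \<in> f" "u \<in> ?B y'"
        using Ab[OF e a] Ab[OF f b] by blast
      then show ?thesis
      proof cases
        case 1
        then have "y = y'" using bags u y eVH[OF e] by blast
        then show ?thesis using 1 y by blast
      next
        case 2
        then have "y = y'" using bags u y eVH[OF f] by blast
        then show ?thesis using 2 by blast
      qed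
    qed
    \<comment> \<open>An end of \<open>b\<close> provides a candidate for the choice in
      \<open>cv\<close>.\<close>
    have "b \<in> E" using A[OF f] b by blast
    then have "b \<noteq> {}" using simple_graph_card_edge(1)[OF G] by fastforce
    then obtain u where u: "u \<in> b" by blast
    then obtain y where y: "y \<in> f" "u \<in> ?B y" using Ab[OF f b] by blast
    have "y \<in> VH - e \<and> \<Union>(fst x) \<inter> ?B y \<noteq> {}"
      using y u ef eVH[OF f] x by auto
    then have "cv e x \<in> VH - e \<and> \<Union>(fst x) \<inter> ?B (cv e x) \<noteq> {}"
      unfolding cv_def by (rule someI)
    moreover then have "cv e x \<in> f" using only by blast
    moreover have "x \<in> Q e" using x a by (simp add: Q_def)
    ultimately show ?thesis unfolding C_def by blast
  qed
  have crossing: "C e \<inter> f \<noteq> {} \<or> C f \<inter> e \<noteq> {}"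
    if e: "e \<in> EH" and f: "f \<in> EH" and ef: "e \<inter> f = {}" and ne: "T e \<inter> T f \<noteq> {}" for e f
  proof -
    obtain z where z: "z \<in> T e" "z \<in> T f" using ne by blast
    have inV: "(\<Union>x\<in>e. ?B x) \<subseteq> V" if "e \<in> EH" for e using bagV eVH[OF that] by blast
    have disj: "(\<Union>x\<in>e. ?B x) \<inter> (\<Union>x\<in>f. ?B x) = {}"
      using bags eVH[OF e] eVH[OF f] ef by blast
    have noint: "p u \<notin> curve_interior (\<gamma> a)" if "u \<in> V" "a \<in> E" for u a
      using D that by (simp add: drawing_def)
    have inj: "inj_on p V" using D by (simp add: drawing_def)
    \<comment> \<open>A point common to both routes is not a vertex point: branch sets of
      independent edges are disjoint, and no vertex lies inside a curve. So it is interior to an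
      edge on each route.\<close>
    have "z \<notin> p ` (\<Union>x\<in>e. ?B x)"
    proof
      assume "z \<in> p ` (\<Union>x\<in>e. ?B x)"
      then obtain u where u: "u \<in> (\<Union>x\<in>e. ?B x)" "z = p u" by blast
      then have "z \<notin> (\<Union>a\<in>A f. curve_interior (\<gamma> a))" using noint A[OF f] inV[OF e] by blast
      then obtain u' where u': "u' \<in> (\<Union>x\<in>f. ?B x)" "z = p u'" using z(2) Ts[OF f] by blast
      have "u = u'" by (rule inj_onD[OF inj]) (use u u' inV[OF e] inV[OF f] in auto)
      then show False using u(1) u'(1) disj by blast
    qed
    then obtain a where a: "a \<in> A e" "z \<in> curve_interior (\<gamma> a)" using z(1) Ts[OF e] by blast
    then have aE: "a \<in> E" using A[OF e] by blast
    have "z \<notin> p ` (\<Union>x\<in>f. ?B x)" using noint a aE inV[OF f] by blast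
    then obtain b where b: "b \<in> A f" "z \<in> curve_interior (\<gamma> b)" using z(2) Ts[OF f] by blast
    then have bE: "b \<in> E" using A[OF f] by blast
    have "a \<noteq> {}" using simple_graph_card_edge(1)[OF G aE] by auto
    then have "a \<noteq> b" using Ab[OF e a(1)] Ab[OF f b(1)] disj by blast
    then have x: "({a, b}, z) \<in> crossings E \<gamma>"
      using a b aE bE unfolding crossings_def by blast
    then have "ch ({a, b}, z) = a \<or> ch ({a, b}, z) = b" using bspec[OF ch x] by simp
    then show ?thesis
      using conflict[OF e f ef a(1) b(1) x] conflict[OF f e _ b(1) a(1) x] ef
      by (auto simp: insert_commute Int_commute)
  qed
  \<comment> \<open>The drawing is moved from \<open>real \<times> real\<close> to the complex
    plane, where weak drawings live.\<close>
  define q where "q z = Complex (fst z) (snd z)" for z :: "real \<times> real"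
  have q: "inj q" by (auto simp: inj_def q_def prod_eq_iff)
  have contq: "continuous_on X q" for X
    unfolding q_def Complex_eq by (intro continuous_intros)
  have "card EH \<le> 3 * 3 * (k * (2 * r + 1) + 1) * card VH"
  proof (rule conflict_free_card_edges[OF H, of C])
    fix e assume e: "e \<in> EH"
    show "C e \<subseteq> VH - e" unfolding C_def by blast
    have "card (C e) \<le> card (cv e ` Q e)" using Q[OF e] unfolding C_def by (intro card_mono) auto
    also have "\<dots> \<le> card (Q e)" using Q[OF e] by (intro card_image_le) simp
    finally show "card (C e) \<le> k * (2 * r + 1)" using Q[OF e] by linarith
  next
    fix S assume S: "S \<subseteq> VH"
    let ?F = "{e\<in>EH. e \<subseteq> S \<and> C e \<inter> S = {}}"
    have "weak_drawing ?F (\<lambda>v. q (p (c v))) (\<lambda>e. q ` T e)"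
      unfolding weak_drawing_def
    proof (intro conjI ballI impI)
      fix e assume "e \<in> ?F"
      then show "path_connected (q ` T e)" "(\<lambda>v. q (p (c v))) ` e \<subseteq> q ` T e"
        using T[of e] by (auto intro!: path_connected_continuous_image contq)
    next
      fix e f assume ef: "e \<in> ?F" "f \<in> ?F" "e \<inter> f = {}"
      then have "C e \<inter> f = {}" "C f \<inter> e = {}" by auto
      then have "T e \<inter> T f = {}" using crossing[of e f] ef by blast
      then show "q ` T e \<inter> q ` T f = {}" using q by (simp add: image_Int[symmetric])
    qed
    then have "weakly_drawable S ?F" unfolding weakly_drawable_def by blast
    moreover have "simple_graph S ?F" using S by (intro simple_graph_subgraph[OF H]) auto
    ultimately show "card ?F \<le> 3 * card S" by (rule weakly_drawable_card_edges[rotated])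
  qed
  then show ?thesis by simp
qed

theorem theorem1:
  fixes V :: "'a set" and E :: "'a set set" and k r :: nat
  assumes "simple_graph V E"
    and "k_gap_planar k V E"
  shows "nabla r V E \<le> 18 * (real k + 1) * (real r + 1)"
  unfolding nabla_def
proof (rule cSup_least)
  \<comment> \<open>The empty minor makes the set of densities nonempty, so its supremum is bounded
    by any upper bound.\<close>
  have "simple_graph ({} :: nat set) {}" "shallow_minor r ({} :: nat set) {} V E"
    by (simp_all add: simple_graph_def shallow_minor_def shallow_model_def)
  then show "{density VH EH | (VH :: nat set) EH. simple_graph VH EH \<and> shallow_minor r VH EH V E} \<noteq> {}"
    by blast
next
  fix d assume "d \<in> {density VH EH | (VH :: nat set) EH. simple_graph VH EH \<and> shallow_minor r VH EH V E}"
  then obtain VH :: "nat set" and EH where d: "d = density VH EH"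
    and H: "simple_graph VH EH" "shallow_minor r VH EH V E" by blast
  show "d \<le> 18 * (real k + 1) * (real r + 1)"
  proof (cases "VH = {}")
    case False
    then have pos: "0 < card VH" using simple_graph_finite(1)[OF H(1)] by (simp add: card_gt_0_iff)
    have "card EH \<le> 9 * (k * (2 * r + 1) + 1) * card VH"
      using shallow_minor_card_edges[OF assms H] .
    \<comment> \<open>Expanded, the left factor is \<open>18 * k * r + 9 * k + 9\<close>.\<close>
    also have "\<dots> \<le> 18 * (k + 1) * (r + 1) * card VH"
      by (intro mult_right_mono) (simp_all add: algebra_simps)
    finally have "real (card EH) \<le> real (18 * (k + 1) * (r + 1) * card VH)"
      by (simp only: of_nat_le_iff)
    then show ?thesis using False pos by (simp add: d density_def field_simps)
  qed (simp add: d density_def)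
qed

end
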